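(* Consider a Hamiltonian system $$\frac{dq^k}{dt}=\frac{\partial H}{\partial p^k}=f^k(q,p),\qquad \frac{dp^k}{dt}=-\frac{\partial H}{\partial q^k}=g^k(q,p),\qquad k=1,\dots,N,$$ with $q^k,p^k\in\mathbb{R}^{d_k}$, $q=(q^1,\dots,q^N)$, $p=(p^1,\dots,p^N)$ and $H$ a smooth real function of $(q,p)$. Apply to it the scheme with real coefficients $b_i^k,a_{ij}^k,\hat b_i^k,\hat a_{ij}^k$ ($k=1,\dots,N$; $i,j=1,\dots,s$) and step size $h$ given by $$\tilde q^k=q^k+h\sum_{i=1}^s b_i^kF_i^k,\qquad Q_i^k=q^k+h\sum_{j=1}^s a_{ij}^kF_j^k,\qquad F_i^k=f^k(Q_i,P_i),$$ $$\tilde p^k=p^k+h\sum_{i=1}^s \hat b_i^kG_i^k,\qquad P_i^k=p^k+h\sum_{j=1}^s \hat a_{ij}^kG_j^k,\qquad G_i^k=g^k(Q_i,P_i),$$ where $Q_i=(Q_i^1,\dots,Q_i^N)$ and $P_i=(P_i^1,\dots,P_i^N)$. If the coefficients satisfy (i) $\hat b_i^kb_j^k=\hat b_i^ka_{ij}^k+b_j^k\hat a_{ji}^k$ for all $i,j,k$, (ii) $b_i^k=\hat b_i^k$ for all $k,i$, and (iii) $b_i^1=b_i^2=\dots=b_i^N$ for all $i$, then the integrator is symplectic, i.e. the update map $(q,p)\mapsto(\tilde q,\tilde p)$ preserves the symplectic form $\sum_{k=1}^N dq^k\wedge dp^k$.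
   Context: The update map $(q,p)\mapsto(\tilde q,\tilde p)$ is considered, as usual, on an open set of initial values (for the given $h$) on which the stage equations have a unique solution $(Q_i,P_i)_{i=1}^s$ depending smoothly on $(q,p)$. Here $dq^k\wedge dp^k=\sum_{a=1}^{d_k}dq^k_a\wedge dp^k_a$. *)

theory Defs
  imports "HOL-Analysis.Analysis"
begin

(* Phase space: coordinates of q = (q^1, ..., q^N) and of p are indexed by one finite type 'n, and
   blk :: 'n => 'k assigns to each coordinate the block it belongs to.  Thus N = CARD('k),
   d_k = card {c. blk c = k}, and q^k is the family of all q $ c with blk c = k; the d_k are
   arbitrary.  Stages are indexed by the finite type 's, with s = CARD('s). *)

type_synonym 'n phase = "(real ^ 'n) \<times> (real ^ 'n)"
type_synonym ('n, 's) stages = "(real ^ 'n ^ 's) \<times> (real ^ 'n ^ 's)"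


(* C^m on an open set S: all iterated directional derivatives of order < m are differentiable on S,
   and those of order m are continuous. For finite-dimensional domains, this is the usual C^m. *)

primrec C_k_on ::
  "nat \<Rightarrow> ('a::euclidean_space) set \<Rightarrow> ('a \<Rightarrow> 'b::real_normed_vector) \<Rightarrow> bool" where
  "C_k_on 0 S f \<longleftrightarrow> continuous_on S f"
| "C_k_on (Suc m) S f \<longleftrightarrow>
     (\<forall>x\<in>S. f differentiable (at x)) \<and>
     (\<forall>v. C_k_on m S (\<lambda>x. frechet_derivative f (at x) v))"

definition smooth_on :: "('a::euclidean_space) set \<Rightarrow> ('a \<Rightarrow> 'b::real_normed_vector) \<Rightarrow> bool" where
  "smooth_on S f \<longleftrightarrow> (\<forall>m. C_k_on m S f)"

definition partial_q :: "('n::finite phase \<Rightarrow> real) \<Rightarrow> 'n phase \<Rightarrow> real ^ 'n" where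
  "partial_q H = (\<lambda>(q, p). \<chi> c. deriv (\<lambda>t. H (q + t *\<^sub>R axis c 1, p)) 0)"

definition partial_p :: "('n::finite phase \<Rightarrow> real) \<Rightarrow> 'n phase \<Rightarrow> real ^ 'n" where
  "partial_p H = (\<lambda>(q, p). \<chi> c. deriv (\<lambda>t. H (q, p + t *\<^sub>R axis c 1)) 0)"


definition stage_eqs ::
  "('n::finite \<Rightarrow> 'k::finite) \<Rightarrow> ('n phase \<Rightarrow> real ^ 'n) \<Rightarrow> ('n phase \<Rightarrow> real ^ 'n) \<Rightarrow>
   ('k \<Rightarrow> 's::finite \<Rightarrow> 's \<Rightarrow> real) \<Rightarrow> ('k \<Rightarrow> 's \<Rightarrow> 's \<Rightarrow> real) \<Rightarrow> real \<Rightarrow>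
   'n phase \<Rightarrow> ('n, 's) stages \<Rightarrow> bool" where
  "stage_eqs blk f g a ahat h = (\<lambda>(q, p) (Q, P).
     \<forall>k i c. blk c = k \<longrightarrow>
       Q $ i $ c = q $ c + h * (\<Sum>j\<in>UNIV. a k i j * f (Q $ j, P $ j) $ c) \<and>
       P $ i $ c = p $ c + h * (\<Sum>j\<in>UNIV. ahat k i j * g (Q $ j, P $ j) $ c))"

(* The next two are meaningful only at points z where the stage equations are uniquely solvable. *)

definition stage_sol ::
  "('n::finite \<Rightarrow> 'k::finite) \<Rightarrow> ('n phase \<Rightarrow> real ^ 'n) \<Rightarrow> ('n phase \<Rightarrow> real ^ 'n) \<Rightarrow>
   ('k \<Rightarrow> 's::finite \<Rightarrow> 's \<Rightarrow> real) \<Rightarrow> ('k \<Rightarrow> 's \<Rightarrow> 's \<Rightarrow> real) \<Rightarrow> real \<Rightarrow>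
   'n phase \<Rightarrow> ('n, 's) stages" where
  "stage_sol blk f g a ahat h z = (THE X. stage_eqs blk f g a ahat h z X)"

definition update_map ::
  "('n::finite \<Rightarrow> 'k::finite) \<Rightarrow> ('n phase \<Rightarrow> real ^ 'n) \<Rightarrow> ('n phase \<Rightarrow> real ^ 'n) \<Rightarrow>
   ('k \<Rightarrow> 's::finite \<Rightarrow> real) \<Rightarrow> ('k \<Rightarrow> 's \<Rightarrow> 's \<Rightarrow> real) \<Rightarrow>
   ('k \<Rightarrow> 's \<Rightarrow> real) \<Rightarrow> ('k \<Rightarrow> 's \<Rightarrow> 's \<Rightarrow> real) \<Rightarrow> real \<Rightarrow>
   'n phase \<Rightarrow> 'n phase" where
  "update_map blk f g b a bhat ahat h = (\<lambda>(q, p).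
     let (Q, P) = stage_sol blk f g a ahat h (q, p) in
       (\<chi> c. q $ c + h * (\<Sum>i\<in>UNIV. b (blk c) i * f (Q $ i, P $ i) $ c),
        \<chi> c. p $ c + h * (\<Sum>i\<in>UNIV. bhat (blk c) i * g (Q $ i, P $ i) $ c)))"


definition dq :: "'n::finite \<Rightarrow> 'n phase \<Rightarrow> real" where
  "dq c v = fst v $ c"

definition dp :: "'n::finite \<Rightarrow> 'n phase \<Rightarrow> real" where
  "dp c v = snd v $ c"

definition wedge :: "('a \<Rightarrow> real) \<Rightarrow> ('a \<Rightarrow> real) \<Rightarrow> 'a \<Rightarrow> 'a \<Rightarrow> real" where
  "wedge \<alpha> \<beta> v w = \<alpha> v * \<beta> w - \<alpha> w * \<beta> v"

definition symplectic_form ::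
  "('n::finite \<Rightarrow> 'k::finite) \<Rightarrow> 'n phase \<Rightarrow> 'n phase \<Rightarrow> real" where
  "symplectic_form blk v w = (\<Sum>k\<in>UNIV. \<Sum>c | blk c = k. wedge (dq c) (dp c) v w)"

(* omega is a 2-form with constant coefficients, so its pullback along phi at z is
   (v, w) |-> omega (D phi(z) v) (D phi(z) w). *)

definition preserves_form_on ::
  "('a::real_normed_vector) set \<Rightarrow> ('a \<Rightarrow> 'a \<Rightarrow> real) \<Rightarrow> ('a \<Rightarrow> 'a) \<Rightarrow> bool" where
  "preserves_form_on U \<omega> \<phi> \<longleftrightarrow>
     (\<forall>z\<in>U. \<phi> differentiable (at z) \<and>
       (\<forall>v w. \<omega> (frechet_derivative \<phi> (at z) v) (frechet_derivative \<phi> (at z) w) = \<omega> v w))"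

end

theory Submission
  imports Defs
begin

text \<open>
  The proof is a computation with differential one-forms on the set of initial values. The quantities
  \<open>q\<close>, \<open>p\<close>, \<open>Q\<^sub>i\<close>, \<open>P\<^sub>i\<close>, \<open>F\<^sub>i\<close> and \<open>G\<^sub>i\<close> are all differentiable functions of the initial value, and
  differentiating the scheme gives the same affine relations between their differentials as between
  the quantities themselves. Write \<open>q'\<close>, \<open>p'\<close> for the updated values. For one coordinate, expand \<open>dq' \<and> dp'\<close> into
  \<open>dq \<and> dp\<close>, terms linear in \<open>h\<close>, and the quadratic terms
  \<open>h\<^sup>2 \<Sum>\<^sub>i\<^sub>j b\<^sub>i bhat\<^sub>j dF\<^sub>i \<and> dG\<^sub>j\<close>. In the linear terms \<open>dq\<close> and \<open>dp\<close> are replaced by \<open>dQ\<^sub>i\<close> and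
  \<open>dP\<^sub>i\<close>, using the stage equations; the first condition on the coefficients says exactly that the
  quadratic terms so created cancel the existing ones. This is lemma \<open>wedge_update\<close>, and it leaves
  \<open>dq \<and> dp + h \<Sum>\<^sub>i (b\<^sub>i dF\<^sub>i \<and> dP\<^sub>i + bhat\<^sub>i dQ\<^sub>i \<and> dG\<^sub>i)\<close>.

  Up to this point each coordinate is treated separately. The remaining terms do not in general vanish
  for a single coordinate, since \<open>H\<close> couples the coordinates. The second and third conditions make
  all weights at stage \<open>i\<close> equal, so that the sum over the coordinates can be taken inside, and then
  \<open>\<Sum>\<^sub>c (dF\<^sub>i\<^sup>c \<and> dP\<^sub>i\<^sup>c + dQ\<^sub>i\<^sup>c \<and> dG\<^sub>i\<^sup>c) = 0\<close>: evaluated on two vectors, the left-hand side is the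
  difference of the two values \<open>D\<^sup>2H(x, y) - D\<^sup>2H(y, x)\<close> of the second derivative at the stage point.
  This is lemma \<open>hamiltonian_field_wedge_cancel\<close>, which rests on the symmetry of second
  derivatives, lemma \<open>hess_symmetric\<close>.
\<close>

section \<open>Symmetry of second derivatives\<close>

text \<open>
  The inner derivative is taken along a fixed vector, so that only derivatives of real-valued functions
  occur. For twice differentiable \<open>H\<close> this is the second derivative as a bilinear form; linearity
  in the last argument is derived from symmetry in \<open>hess_linear\<close>.
\<close>

definition hess :: "('a::euclidean_space \<Rightarrow> real) \<Rightarrow> 'a \<Rightarrow> 'a \<Rightarrow> 'a \<Rightarrow> real" where
  "hess H x v w = frechet_derivative (\<lambda>y. frechet_derivative H (at y) w) (at x) v"

lemma smooth_on_imp_C2: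
  assumes "smooth_on UNIV H"
  shows "H differentiable (at x)"
    and "(\<lambda>y. frechet_derivative H (at y) w) differentiable (at x)"
    and "continuous_on UNIV (\<lambda>x. hess H x v w)"
proof -
  have "C_k_on (Suc (Suc 0)) UNIV H"
    using assms by (auto simp only: smooth_on_def)
  then show "H differentiable (at x)"
    and "(\<lambda>y. frechet_derivative H (at y) w) differentiable (at x)"
    and "continuous_on UNIV (\<lambda>x. hess H x v w)"
    by (auto simp: hess_def)
qed

lemma DERIV_along_line:
  fixes \<phi> :: "'a::real_normed_vector \<Rightarrow> real"
  assumes "\<phi> differentiable (at (x + t *\<^sub>R u))"
  shows "((\<lambda>t. \<phi> (x + t *\<^sub>R u)) has_real_derivative
           frechet_derivative \<phi> (at (x + t *\<^sub>R u)) u) (at t)"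
proof -
  let ?D = "frechet_derivative \<phi> (at (x + t *\<^sub>R u))"
  have D: "(\<phi> has_derivative ?D) (at (x + t *\<^sub>R u))"
    using assms by (simp add: frechet_derivative_works)
  have "((\<lambda>t. x + t *\<^sub>R u) has_derivative (\<lambda>s. s *\<^sub>R u)) (at t)"
    by (auto intro!: derivative_eq_intros)
  from diff_chain_at[OF this D]
  have "((\<lambda>t. \<phi> (x + t *\<^sub>R u)) has_derivative (\<lambda>s. ?D (s *\<^sub>R u))) (at t)"
    by (simp add: o_def)
  moreover have "(\<lambda>s. ?D (s *\<^sub>R u)) = (\<lambda>s. ?D u * s)"
    using linear_scale[OF has_derivative_linear[OF D]] by (auto simp: mult.commute)
  ultimately show ?thesis
    by (simp add: has_field_derivative_def)
qed

text \<open>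
  The second difference is an increment along \<open>v\<close> of an increment along \<open>u\<close>. The mean value theorem,
  applied first along \<open>v\<close> and then along \<open>u\<close>, turns it into a mixed derivative at an intermediate
  point. The second difference itself is symmetric in \<open>u\<close> and \<open>v\<close>, which is what forces the symmetry
  of the mixed derivative.
\<close>

lemma second_difference_mean_value:
  fixes H :: "'a::euclidean_space \<Rightarrow> real"
  assumes d1: "\<And>x. H differentiable (at x)"
    and d2: "\<And>x. (\<lambda>y. frechet_derivative H (at y) v) differentiable (at x)"
    and t: "0 < t"
  shows "\<exists>r s. 0 < r \<and> r < t \<and> 0 < s \<and> s < t \<and>
    H (x + t *\<^sub>R u + t *\<^sub>R v) - H (x + t *\<^sub>R u) - H (x + t *\<^sub>R v) + H x
      = t * t * hess H (x + r *\<^sub>R v + s *\<^sub>R u) u v"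
proof -
  let ?D = "\<lambda>y. frechet_derivative H (at y) v"
  let ?\<psi> = "\<lambda>r. H (x + t *\<^sub>R u + r *\<^sub>R v) - H (x + r *\<^sub>R v)"
  have "DERIV ?\<psi> r :> ?D (x + t *\<^sub>R u + r *\<^sub>R v) - ?D (x + r *\<^sub>R v)" for r
    by (intro DERIV_diff DERIV_along_line d1)
  from MVT2[OF t this] obtain r where r: "0 < r" "r < t"
    "?\<psi> t - ?\<psi> 0 = (t - 0) * (?D (x + t *\<^sub>R u + r *\<^sub>R v) - ?D (x + r *\<^sub>R v))"
    by blast
  let ?\<chi> = "\<lambda>s. ?D (x + r *\<^sub>R v + s *\<^sub>R u)"
  have "DERIV ?\<chi> s :> hess H (x + r *\<^sub>R v + s *\<^sub>R u) u v" for s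
    unfolding hess_def by (intro DERIV_along_line d2)
  from MVT2[OF t this] obtain s where s: "0 < s" "s < t"
    "?\<chi> t - ?\<chi> 0 = (t - 0) * hess H (x + r *\<^sub>R v + s *\<^sub>R u) u v"
    by blast
  have swap: "x + r *\<^sub>R v + t *\<^sub>R u = x + t *\<^sub>R u + r *\<^sub>R v"
    by (simp add: algebra_simps)
  have "?\<psi> t - ?\<psi> 0 = t * t * hess H (x + r *\<^sub>R v + s *\<^sub>R u) u v"
    using r(3) s(3) by (simp add: swap)
  then show ?thesis
    using r(1,2) s(1,2) by (intro exI[of _ r] exI[of _ s]) simp
qed

lemma tendsto_along_mean_value_points:
  fixes \<phi> :: "'a::euclidean_space \<Rightarrow> real"
  assumes c: "continuous_on UNIV \<phi>"
    and r: "\<And>n. 0 < r n \<and> r n < inverse (real (Suc n))"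
    and s: "\<And>n. 0 < s n \<and> s n < inverse (real (Suc n))"
  shows "(\<lambda>n. \<phi> (x + r n *\<^sub>R v + s n *\<^sub>R u)) \<longlonglongrightarrow> \<phi> x"
proof -
  have r0: "r \<longlonglongrightarrow> 0"
    by (rule tendsto_sandwich[OF _ _ tendsto_const LIMSEQ_inverse_real_of_nat])
       (use r in \<open>auto intro!: always_eventually less_imp_le simp del: of_nat_Suc\<close>)
  have s0: "s \<longlonglongrightarrow> 0"
    by (rule tendsto_sandwich[OF _ _ tendsto_const LIMSEQ_inverse_real_of_nat])
       (use s in \<open>auto intro!: always_eventually less_imp_le simp del: of_nat_Suc\<close>)
  have "(\<lambda>n. x + r n *\<^sub>R v + s n *\<^sub>R u) \<longlonglongrightarrow> x + 0 *\<^sub>R v + 0 *\<^sub>R u"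
    by (intro tendsto_intros r0 s0)
  then have "(\<lambda>n. x + r n *\<^sub>R v + s n *\<^sub>R u) \<longlonglongrightarrow> x"
    by simp
  moreover have "isCont \<phi> x"
    using c by (simp add: continuous_on_eq_continuous_at)
  ultimately show ?thesis
    by (rule isCont_tendsto_compose[rotated])
qed

text \<open>
  Evaluate the second difference with step \<open>1/(n+1)\<close> in both orders. The two mixed derivatives so
  obtained agree, at two different points that both tend to \<open>x\<close>, and continuity of the mixed
  derivatives carries the equality over to \<open>x\<close>.
\<close>

lemma hess_symmetric:
  fixes H :: "'a::euclidean_space \<Rightarrow> real"
  assumes H: "smooth_on UNIV H"
  shows "hess H x u v = hess H x v u"
proof -
  let ?t = "\<lambda>n. inverse (real (Suc n))"
  let ?\<Delta> = "\<lambda>t u v. H (x + t *\<^sub>R u + t *\<^sub>R v) - H (x + t *\<^sub>R u) - H (x + t *\<^sub>R v) + H x"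
  note C2 = smooth_on_imp_C2[OF H]
  have mv: "\<forall>n. \<exists>r s. 0 < r \<and> r < ?t n \<and> 0 < s \<and> s < ?t n \<and>
      ?\<Delta> (?t n) u v = ?t n * ?t n * hess H (x + r *\<^sub>R v + s *\<^sub>R u) u v" for u v
    by (intro allI second_difference_mean_value C2) simp
  obtain r s where rs: "\<And>n. 0 < r n \<and> r n < ?t n \<and> 0 < s n \<and> s n < ?t n \<and>
      ?\<Delta> (?t n) u v = ?t n * ?t n * hess H (x + r n *\<^sub>R v + s n *\<^sub>R u) u v"
    using mv[of u v] by metis
  obtain r' s' where rs': "\<And>n. 0 < r' n \<and> r' n < ?t n \<and> 0 < s' n \<and> s' n < ?t n \<and>
      ?\<Delta> (?t n) v u = ?t n * ?t n * hess H (x + r' n *\<^sub>R u + s' n *\<^sub>R v) v u"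
    using mv[of v u] by metis
  have "hess H (x + r n *\<^sub>R v + s n *\<^sub>R u) u v = hess H (x + r' n *\<^sub>R u + s' n *\<^sub>R v) v u" for n
  proof -
    have "?\<Delta> (?t n) u v = ?\<Delta> (?t n) v u"
      by (simp add: algebra_simps)
    then have "?t n * ?t n * hess H (x + r n *\<^sub>R v + s n *\<^sub>R u) u v =
        ?t n * ?t n * hess H (x + r' n *\<^sub>R u + s' n *\<^sub>R v) v u"
      using rs[of n] rs'[of n] by argo
    moreover have "?t n * ?t n \<noteq> 0" by simp
    ultimately show ?thesis
      using mult_left_cancel by blast
  qed
  moreover have "(\<lambda>n. hess H (x + r n *\<^sub>R v + s n *\<^sub>R u) u v) \<longlonglongrightarrow> hess H x u v"
    using rs by (intro tendsto_along_mean_value_points C2(3)) blast+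
  moreover have "(\<lambda>n. hess H (x + r' n *\<^sub>R u + s' n *\<^sub>R v) v u) \<longlonglongrightarrow> hess H x v u"
    using rs' by (intro tendsto_along_mean_value_points C2(3)) blast+
  ultimately show ?thesis
    using LIMSEQ_unique by simp
qed

lemma hess_linear:
  assumes "smooth_on UNIV H"
  shows "linear (\<lambda>w. hess H x v w)"
proof -
  have "linear (\<lambda>w. hess H x w v)"
    unfolding hess_def
    by (rule linear_frechet_derivative[OF smooth_on_imp_C2(2)[OF assms]])
  then show ?thesis
    by (simp add: hess_symmetric[OF assms, of x v])
qed

section \<open>The Hamiltonian vector field\<close>

lemma partial_eq_frechet_derivative:
  assumes "\<And>x. H differentiable (at x)"
  shows "partial_q H x $ c = frechet_derivative H (at x) (axis c 1, 0)"
    and "partial_p H x $ c = frechet_derivative H (at x) (0, axis c 1)"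
proof -
  obtain q p where x: "x = (q, p)" by force
  have line: "deriv (\<lambda>t. H (x + t *\<^sub>R u)) 0 = frechet_derivative H (at x) u" for u
    using DERIV_along_line[of H x 0 u] assms by (intro DERIV_imp_deriv) simp
  show "partial_q H x $ c = frechet_derivative H (at x) (axis c 1, 0)"
    using line[of "(axis c 1, 0)"] by (simp add: partial_q_def x)
  show "partial_p H x $ c = frechet_derivative H (at x) (0, axis c 1)"
    using line[of "(0, axis c 1)"] by (simp add: partial_p_def x)
qed

lemma has_derivative_vec_iff:
  fixes F :: "'a::real_normed_vector \<Rightarrow> real ^ 'n::finite"
  shows "(F has_derivative F') (at x) \<longleftrightarrow>
    (\<forall>c. ((\<lambda>y. F y $ c) has_derivative (\<lambda>v. F' v $ c)) (at x))"
  by (subst has_derivative_componentwise_within) (auto simp: Basis_vec_def inner_axis)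

lemma partial_has_derivative:
  assumes H: "smooth_on UNIV H"
  shows "(partial_q H has_derivative (\<lambda>v. \<chi> c. hess H x v (axis c 1, 0))) (at x)"
    and "(partial_p H has_derivative (\<lambda>v. \<chi> c. hess H x v (0, axis c 1))) (at x)"
proof -
  have "((\<lambda>y. frechet_derivative H (at y) w) has_derivative (\<lambda>v. hess H x v w)) (at x)" for w
    using smooth_on_imp_C2(2)[OF H] unfolding hess_def by (simp add: frechet_derivative_works)
  then show "(partial_q H has_derivative (\<lambda>v. \<chi> c. hess H x v (axis c 1, 0))) (at x)"
    and "(partial_p H has_derivative (\<lambda>v. \<chi> c. hess H x v (0, axis c 1))) (at x)"
    by (simp_all add: has_derivative_vec_iff
        partial_eq_frechet_derivative[OF smooth_on_imp_C2(1)[OF H]])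
qed

text \<open>
  The coefficients on the right are the coordinates of the derivative of the gradient of \<open>H\<close> along
  \<open>v\<close>, in the form in which \<open>partial_has_derivative\<close> produces them for the Hamiltonian vector field.
\<close>

lemma hess_coordinates:
  fixes w :: "'n::finite phase"
  assumes "smooth_on UNIV H"
  shows "hess H x v w =
    (\<Sum>c\<in>UNIV. fst w $ c * hess H x v (axis c 1, 0) + snd w $ c * hess H x v (0, axis c 1))"
proof -
  note lin = hess_linear[OF assms, of x v]
  have basis: "(\<Sum>c\<in>UNIV. (y $ c) *\<^sub>R axis c 1) = y" for y :: "real ^ 'n"
    using basis_expansion[of y] by (simp add: scalar_mult_eq_scaleR)
  have "w = (\<Sum>c\<in>UNIV. fst w $ c *\<^sub>R (axis c 1, 0) + snd w $ c *\<^sub>R (0, axis c 1))"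
    by (rule prod_eqI) (simp_all add: sum.distrib fst_sum snd_sum basis)
  then have "hess H x v w = hess H x v
      (\<Sum>c\<in>UNIV. fst w $ c *\<^sub>R (axis c 1, 0) + snd w $ c *\<^sub>R (0, axis c 1))"
    by simp
  then show ?thesis
    by (simp only: linear_sum[OF lin] linear_add[OF lin] linear_scale[OF lin] real_scaleR_def)
qed

text \<open>
  This is the infinitesimal symplecticity of a Hamiltonian vector field \<open>(f, g)\<close>, pulled back along a
  map with derivative \<open>Y\<close>: the two Hessian forms are \<open>df\<^sup>c\<close> and \<open>dg\<^sup>c\<close>. After summation over \<open>c\<close> the
  terms group into the Hessian applied to \<open>(Y v, Y w)\<close> minus the Hessian applied to \<open>(Y w, Y v)\<close>.
\<close>

lemma hamiltonian_field_wedge_cancel: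
  fixes Y :: "'a \<Rightarrow> 'n::finite phase"
  assumes "smooth_on UNIV H"
  shows "(\<Sum>c\<in>UNIV. wedge (\<lambda>v. hess H x (Y v) (0, axis c 1)) (\<lambda>v. snd (Y v) $ c) v w
      + wedge (\<lambda>v. fst (Y v) $ c) (\<lambda>v. - hess H x (Y v) (axis c 1, 0)) v w) = 0"
    (is "?S = 0")
proof -
  have "?S = hess H x (Y v) (Y w) - hess H x (Y w) (Y v)"
    unfolding hess_coordinates[OF assms, of x "Y v" "Y w"] hess_coordinates[OF assms, of x "Y w" "Y v"]
      sum_subtractf[symmetric]
    by (intro sum.cong) (simp_all add: wedge_def algebra_simps)
  then show ?thesis
    using hess_symmetric[OF assms] by simp
qed

section \<open>Exterior algebra of the scheme\<close>

lemma wedge_affine_left: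
  "wedge (\<lambda>v. \<alpha> v + h * (\<Sum>i\<in>I. k i * A i v)) \<gamma> v w
    = wedge \<alpha> \<gamma> v w + h * (\<Sum>i\<in>I. k i * wedge (A i) \<gamma> v w)"
  by (simp add: wedge_def algebra_simps sum_distrib_left sum_subtractf)

lemma wedge_affine_right:
  "wedge \<gamma> (\<lambda>v. \<alpha> v + h * (\<Sum>i\<in>I. k i * A i v)) v w
    = wedge \<gamma> \<alpha> v w + h * (\<Sum>i\<in>I. k i * wedge \<gamma> (A i) v w)"
  by (simp add: wedge_def algebra_simps sum_distrib_left sum_subtractf)

text \<open>
  Replacing \<open>dp\<close> by \<open>dP\<^sub>i\<close> in \<open>b\<^sub>i dF\<^sub>i \<and> dp\<close> and \<open>dq\<close> by \<open>dQ\<^sub>j\<close> in \<open>bhat\<^sub>j dq \<and> dG\<^sub>j\<close> changes the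
  coefficient of \<open>h\<^sup>2 dF\<^sub>i \<and> dG\<^sub>j\<close> from \<open>b\<^sub>i bhat\<^sub>j\<close> to
  \<open>b\<^sub>i bhat\<^sub>j - b\<^sub>i ahat\<^sub>i\<^sub>j - bhat\<^sub>j a\<^sub>j\<^sub>i\<close>, which is zero by the condition on the coefficients.
\<close>

lemma wedge_update:
  fixes F G Q P :: "'s::finite \<Rightarrow> 'a \<Rightarrow> real" and q p :: "'a \<Rightarrow> real"
  assumes Q: "\<And>i. Q i = (\<lambda>v. q v + h * (\<Sum>j\<in>UNIV. a i j * F j v))"
    and P: "\<And>i. P i = (\<lambda>v. p v + h * (\<Sum>j\<in>UNIV. ahat i j * G j v))"
    and cond: "\<And>i j. bhat i * b j = bhat i * a i j + b j * ahat j i"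
  shows "wedge (\<lambda>v. q v + h * (\<Sum>i\<in>UNIV. b i * F i v))
               (\<lambda>v. p v + h * (\<Sum>i\<in>UNIV. bhat i * G i v)) v w
    = wedge q p v w
      + h * (\<Sum>i\<in>UNIV. b i * wedge (F i) (P i) v w + bhat i * wedge (Q i) (G i) v w)"
proof -
  let ?W = "\<lambda>i j. wedge (F i) (G j) v w"
  have "(\<Sum>i\<in>UNIV. b i * (\<Sum>j\<in>UNIV. ahat i j * ?W i j))
      + (\<Sum>j\<in>UNIV. bhat j * (\<Sum>i\<in>UNIV. a j i * ?W i j))
      = (\<Sum>i\<in>UNIV. \<Sum>j\<in>UNIV. b i * (ahat i j * ?W i j) + bhat j * (a j i * ?W i j))"
    by (simp add: sum_distrib_left sum.distrib) (rule sum.swap)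
  also have "\<dots> = (\<Sum>i\<in>UNIV. \<Sum>j\<in>UNIV. b i * (bhat j * ?W i j))"
  proof (intro sum.cong refl)
    fix i j
    have "b i * (ahat i j * ?W i j) + bhat j * (a j i * ?W i j)
        = (bhat j * a j i + b i * ahat i j) * ?W i j"
      by (simp add: algebra_simps)
    then show "b i * (ahat i j * ?W i j) + bhat j * (a j i * ?W i j) = b i * (bhat j * ?W i j)"
      by (simp add: cond[symmetric] mult_ac)
  qed
  finally have quad: "(\<Sum>i\<in>UNIV. b i * (\<Sum>j\<in>UNIV. bhat j * ?W i j))
      = (\<Sum>i\<in>UNIV. b i * (\<Sum>j\<in>UNIV. ahat i j * ?W i j))
      + (\<Sum>j\<in>UNIV. bhat j * (\<Sum>i\<in>UNIV. a j i * ?W i j))"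
    by (simp add: sum_distrib_left)
  have affine: "(\<Sum>i\<in>UNIV. k i * (x i + h * y i)) = (\<Sum>i\<in>UNIV. k i * x i) + h * (\<Sum>i\<in>UNIV. k i * y i)"
    for k x y :: "'s \<Rightarrow> real"
    by (simp add: sum.distrib sum_distrib_left algebra_simps)
  show ?thesis
    unfolding Q P wedge_affine_left wedge_affine_right affine sum.distrib quad
    by (simp add: algebra_simps)
qed

lemma symplectic_form_coordinates:
  "symplectic_form blk v w = (\<Sum>c\<in>UNIV. wedge (dq c) (dp c) v w)"
  unfolding symplectic_form_def using sum.group[of UNIV UNIV blk "\<lambda>c. wedge (dq c) (dp c) v w"]
  by simp

section \<open>Symplecticity of the scheme\<close>

theorem theorem5p3:
  fixes blk :: "'n::finite \<Rightarrow> 'k::finite"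
    and H :: "'n phase \<Rightarrow> real"
    and f g :: "'n phase \<Rightarrow> real ^ 'n"
    and b bhat :: "'k \<Rightarrow> 's::finite \<Rightarrow> real"
    and a ahat :: "'k \<Rightarrow> 's \<Rightarrow> 's \<Rightarrow> real"
    and h :: real
    and U :: "'n phase set"
  assumes H_smooth: "smooth_on UNIV H"
    and f_eq: "\<And>z. f z = partial_p H z"
    and g_eq: "\<And>z. g z = - partial_q H z"
    and U_open: "open U"
    and stages_unique: "\<And>z. z \<in> U \<Longrightarrow> \<exists>!X. stage_eqs blk f g a ahat h z X"
    and stages_smooth: "smooth_on U (stage_sol blk f g a ahat h)"
    and cond_i: "\<And>i j k. bhat k i * b k j = bhat k i * a k i j + b k j * ahat k j i"
    and cond_ii: "\<And>k i. b k i = bhat k i"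
    and cond_iii: "\<And>k l i. b k i = b l i"
  shows "preserves_form_on U (symplectic_form blk) (update_map blk f g b a bhat ahat h)"
proof -
  define X where "X = stage_sol blk f g a ahat h"
  define Y where "Y i y = (fst (X y) $ i, snd (X y) $ i)" for i y
  let ?\<Phi> = "update_map blk f g b a bhat ahat h"
  have \<Phi>_eq: "?\<Phi> y = (\<chi> c. fst y $ c + h * (\<Sum>i\<in>UNIV. b (blk c) i * f (Y i y) $ c),
                   \<chi> c. snd y $ c + h * (\<Sum>i\<in>UNIV. bhat (blk c) i * g (Y i y) $ c))" for y
    by (simp add: update_map_def X_def Y_def split: prod.splits)
  have stages: "fst (Y i y) $ c = fst y $ c + h * (\<Sum>j\<in>UNIV. a (blk c) i j * f (Y j y) $ c)"
    "snd (Y i y) $ c = snd y $ c + h * (\<Sum>j\<in>UNIV. ahat (blk c) i j * g (Y j y) $ c)"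
    if "y \<in> U" for y i c
  proof -
    have "stage_eqs blk f g a ahat h y (X y)"
      unfolding X_def stage_sol_def by (rule theI'[OF stages_unique[OF that]])
    then show "fst (Y i y) $ c = fst y $ c + h * (\<Sum>j\<in>UNIV. a (blk c) i j * f (Y j y) $ c)"
      "snd (Y i y) $ c = snd y $ c + h * (\<Sum>j\<in>UNIV. ahat (blk c) i j * g (Y j y) $ c)"
      by (auto simp: stage_eqs_def Y_def split: prod.splits)
  qed
  have "?\<Phi> differentiable (at z) \<and> (\<forall>v w. symplectic_form blk
          (frechet_derivative ?\<Phi> (at z) v) (frechet_derivative ?\<Phi> (at z) w)
        = symplectic_form blk v w)" if z: "z \<in> U" for z
  proof -
    have "C_k_on (Suc 0) U X"
      using stages_smooth by (auto simp only: smooth_on_def X_def)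
    then obtain X' where X': "(X has_derivative X') (at z)"
      using z by (auto simp: differentiable_def)
    define Y' where "Y' i v = (fst (X' v) $ i, snd (X' v) $ i)" for i v
    have Y': "(Y i has_derivative Y' i) (at z)" for i
      unfolding Y_def Y'_def
      by (intro has_derivative_Pair bounded_linear.has_derivative[OF bounded_linear_vec_nth]
          has_derivative_fst has_derivative_snd X')
    define F' where "F' i c v = hess H (Y i z) (Y' i v) (0, axis c 1)" for i c v
    define G' where "G' i c v = - hess H (Y i z) (Y' i v) (axis c 1, 0)" for i c v
    have F': "((\<lambda>y. f (Y i y) $ c) has_derivative F' i c) (at z)" for i c
      using diff_chain_at[OF Y' partial_has_derivative(2)[OF H_smooth]]
      by (simp add: has_derivative_vec_iff o_def f_eq F'_def[abs_def])
    have G': "((\<lambda>y. g (Y i y) $ c) has_derivative G' i c) (at z)" for i c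
      using diff_chain_at[OF Y' partial_has_derivative(1)[OF H_smooth]]
      by (auto simp: has_derivative_vec_iff o_def g_eq G'_def[abs_def] intro!: has_derivative_minus)
    have coord: "((\<lambda>y. fst y $ c) has_derivative dq c) (at z)"
      "((\<lambda>y. snd y $ c) has_derivative dp c) (at z)" for c
      unfolding dq_def[abs_def] dp_def[abs_def]
      by (intro bounded_linear.has_derivative[OF bounded_linear_vec_nth]
          has_derivative_fst has_derivative_snd has_derivative_ident)+
    have affF: "((\<lambda>y. fst y $ c + h * (\<Sum>i\<in>UNIV. \<beta> i * f (Y i y) $ c)) has_derivative
        (\<lambda>v. dq c v + h * (\<Sum>i\<in>UNIV. \<beta> i * F' i c v))) (at z)" for c \<beta>
      by (intro has_derivative_add has_derivative_mult_right has_derivative_sum coord F')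
    have affG: "((\<lambda>y. snd y $ c + h * (\<Sum>i\<in>UNIV. \<beta> i * g (Y i y) $ c)) has_derivative
        (\<lambda>v. dp c v + h * (\<Sum>i\<in>UNIV. \<beta> i * G' i c v))) (at z)" for c \<beta>
      by (intro has_derivative_add has_derivative_mult_right has_derivative_sum coord G')
    \<comment> \<open>The stage equations hold on the whole open set, not only at \<open>z\<close>, so both sides have the same
      derivative at \<open>z\<close>.\<close>
    have dQ: "(\<lambda>v. fst (Y' i v) $ c) =
        (\<lambda>v. dq c v + h * (\<Sum>j\<in>UNIV. a (blk c) i j * F' j c v))" for i c
    proof (rule has_derivative_unique)
      show "((\<lambda>y. fst (Y i y) $ c) has_derivative (\<lambda>v. fst (Y' i v) $ c)) (at z)"
        by (intro bounded_linear.has_derivative[OF bounded_linear_vec_nth] has_derivative_fst Y')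
      show "((\<lambda>y. fst (Y i y) $ c) has_derivative
          (\<lambda>v. dq c v + h * (\<Sum>j\<in>UNIV. a (blk c) i j * F' j c v))) (at z)"
        by (rule has_derivative_transform_within_open[OF affF U_open z]) (simp add: stages)
    qed
    have dP: "(\<lambda>v. snd (Y' i v) $ c) =
        (\<lambda>v. dp c v + h * (\<Sum>j\<in>UNIV. ahat (blk c) i j * G' j c v))" for i c
    proof (rule has_derivative_unique)
      show "((\<lambda>y. snd (Y i y) $ c) has_derivative (\<lambda>v. snd (Y' i v) $ c)) (at z)"
        by (intro bounded_linear.has_derivative[OF bounded_linear_vec_nth] has_derivative_snd Y')
      show "((\<lambda>y. snd (Y i y) $ c) has_derivative
          (\<lambda>v. dp c v + h * (\<Sum>j\<in>UNIV. ahat (blk c) i j * G' j c v))) (at z)"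
        by (rule has_derivative_transform_within_open[OF affG U_open z]) (simp add: stages)
    qed
    define \<Phi>' where "\<Phi>' v =
      ((\<chi> c. dq c v + h * (\<Sum>i\<in>UNIV. b (blk c) i * F' i c v)) :: real ^ 'n,
       (\<chi> c. dp c v + h * (\<Sum>i\<in>UNIV. bhat (blk c) i * G' i c v)) :: real ^ 'n)" for v
    have \<Phi>': "(?\<Phi> has_derivative \<Phi>') (at z)"
      unfolding \<Phi>_eq[abs_def] \<Phi>'_def[abs_def]
      by (intro has_derivative_Pair) (simp_all add: has_derivative_vec_iff affF affG)
    have "symplectic_form blk (\<Phi>' v) (\<Phi>' w) = symplectic_form blk v w" for v w
    proof -
      \<comment> \<open>The weights of an arbitrary block \<open>k0\<close> represent the common weights of all blocks.\<close>
      fix k0 :: 'k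
      let ?\<omega> = "\<lambda>i c. wedge (F' i c) (\<lambda>v. snd (Y' i v) $ c) v w
                       + wedge (\<lambda>v. fst (Y' i v) $ c) (G' i c) v w"
      have "symplectic_form blk (\<Phi>' v) (\<Phi>' w) =
          (\<Sum>c\<in>UNIV. wedge (\<lambda>v. dq c v + h * (\<Sum>i\<in>UNIV. b (blk c) i * F' i c v))
                         (\<lambda>v. dp c v + h * (\<Sum>i\<in>UNIV. bhat (blk c) i * G' i c v)) v w)"
        by (simp add: symplectic_form_coordinates wedge_def \<Phi>'_def dq_def dp_def)
      also have "\<dots> = (\<Sum>c\<in>UNIV. wedge (dq c) (dp c) v w + h * (\<Sum>i\<in>UNIV.
            b (blk c) i * wedge (F' i c) (\<lambda>v. snd (Y' i v) $ c) v w
            + bhat (blk c) i * wedge (\<lambda>v. fst (Y' i v) $ c) (G' i c) v w))"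
        by (intro sum.cong refl wedge_update[OF dQ dP cond_i])
      also have "\<dots> = (\<Sum>c\<in>UNIV. wedge (dq c) (dp c) v w + h * (\<Sum>i\<in>UNIV. b k0 i * ?\<omega> i c))"
      proof (intro sum.cong refl)
        fix c
        have "b (blk c) i = b k0 i" "bhat (blk c) i = b k0 i" for i
          using cond_ii cond_iii by metis+
        then show "wedge (dq c) (dp c) v w + h * (\<Sum>i\<in>UNIV.
              b (blk c) i * wedge (F' i c) (\<lambda>v. snd (Y' i v) $ c) v w
              + bhat (blk c) i * wedge (\<lambda>v. fst (Y' i v) $ c) (G' i c) v w)
            = wedge (dq c) (dp c) v w + h * (\<Sum>i\<in>UNIV. b k0 i * ?\<omega> i c)"
          by (simp add: distrib_left)
      qed
      also have "\<dots> = symplectic_form blk v w + h * (\<Sum>c\<in>UNIV. \<Sum>i\<in>UNIV. b k0 i * ?\<omega> i c)"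
        by (simp only: symplectic_form_coordinates sum.distrib sum_distrib_left)
      also have "(\<Sum>c\<in>UNIV. \<Sum>i\<in>UNIV. b k0 i * ?\<omega> i c) = (\<Sum>i\<in>UNIV. b k0 i * (\<Sum>c\<in>UNIV. ?\<omega> i c))"
        by (subst sum.swap) (simp only: sum_distrib_left)
      also have "\<dots> = 0"
        by (simp only: F'_def[abs_def] G'_def[abs_def]
            hamiltonian_field_wedge_cancel[OF H_smooth] mult_zero_right sum.neutral_const)
      finally show ?thesis by simp
    qed
    then show ?thesis
      using \<Phi>' frechet_derivative_at[OF \<Phi>'] by (auto simp: differentiable_def)
  qed
  then show ?thesis
    by (simp add: preserves_form_on_def)
qed

end
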